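(* Let $k\ge 1$ be an integer, let $p_1,\dots,p_k\ge 0$ with $\sum_{l=1}^k p_l=1$, and let $(u_n)_{n\ge 0}$ be the renewal masses of the random walk $S$ with step distribution $(p_l)_{1\le l\le k}$. Let $m_k=\min_{l\ge1}u_l$, and for $1\le n\le k$ let $$Q_n=Q_n(p_1,\dots,p_{n-1})=\prod_{j=1}^{n-1}\sum_{l=1}^{j}p_l .$$ Then $m_k\ge Q_k$. Furthermore, for any $1\le n\le k-1$, $u_n\ge Q_{n+1}$.
   Context: Let $(X_i)_{i\ge1}$ be i.i.d. random variables with values in $\{1,\dots,k\}$ and $\mathbb{P}(X_1=l)=p_l$ for $1\le l\le k$. Let $S_0=0$ and $S_n=\sum_{i=1}^n X_i$ for $n\ge 1$. The renewal masses are $u_n=\mathbb{P}(n\in\{S_0,S_1,\dots\})=\sum_{l=0}^\infty\mathbb{P}(S_l=n)$, $n\ge 0$. Thus $u_0=1$ and $u_n=\sum_{l=1}^{\min\{n,k\}}p_l u_{n-l}$ for $n\ge 1$. Empty products equal $1$, so $Q_1=1$. *)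

theory Defs
  imports "HOL-Probability.Probability"
begin

text \<open>The steps are \<open>X 1, X 2, \<dots>\<close>; the value \<open>X 0\<close> is never used.\<close>

definition walk :: "(nat \<Rightarrow> 'a \<Rightarrow> nat) \<Rightarrow> nat \<Rightarrow> 'a \<Rightarrow> nat" where
  "walk X n \<omega> = (\<Sum>i=1..n. X i \<omega>)"

text \<open>
  \<open>step_sequence M k p X\<close>: the \<open>X i\<close>, \<open>i \<ge> 1\<close>, are i.i.d. random variables on the probability
  space \<open>M\<close> with values in \<open>{1..k}\<close> and \<open>P(X i = l) = p l\<close>. That the values lie in \<open>{1..k}\<close> is part
  of measurability into \<open>count_space {1..k}\<close>, which \<open>indep_vars\<close> includes.
\<close>

definition step_sequence ::
    "'a measure \<Rightarrow> nat \<Rightarrow> (nat \<Rightarrow> real) \<Rightarrow> (nat \<Rightarrow> 'a \<Rightarrow> nat) \<Rightarrow> bool" where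
  "step_sequence M k p X \<longleftrightarrow>
     prob_space M \<and>
     prob_space.indep_vars M (\<lambda>_. count_space {1..k}) X {1..} \<and>
     (\<forall>i\<ge>1. \<forall>l\<in>{1..k}. measure M {\<omega> \<in> space M. X i \<omega> = l} = p l)"

definition renewal_mass :: "'a measure \<Rightarrow> (nat \<Rightarrow> 'a \<Rightarrow> nat) \<Rightarrow> nat \<Rightarrow> real" where
  "renewal_mass M X n = measure M {\<omega> \<in> space M. n \<in> range (\<lambda>j. walk X j \<omega>)}"

text \<open>
  A minimum over an infinite index set, so \<open>Min\<close> does not apply. \<open>LEAST\<close> is specified only if the
  minimum is attained. It is attained for the walks considered here: for \<open>n > k\<close>, \<open>u n\<close> is a convex
  combination of \<open>u (n - k), \<dots>, u (n - 1)\<close>, so some \<open>l \<in> {1..k}\<close> realises it.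
\<close>

definition min_renewal_mass :: "'a measure \<Rightarrow> (nat \<Rightarrow> 'a \<Rightarrow> nat) \<Rightarrow> real" where
  "min_renewal_mass M X = (LEAST x. x \<in> renewal_mass M X ` {1..})"

definition Q :: "(nat \<Rightarrow> real) \<Rightarrow> nat \<Rightarrow> real" where
  "Q p n = (\<Prod>j=1..n-1. \<Sum>l=1..j. p l)"

end

theory Submission
  imports Defs
begin

text \<open>
  Everything follows from the renewal equation
  \<open>u n = (\<Sum>l=1..min n k. p l * u (n - l))\<close>, \<open>u 0 = 1\<close>. Write \<open>P n = p 1 + \<dots> + p n\<close>, so that
  \<open>Q (n + 1) = Q n * P n\<close> and, since \<open>P n \<le> 1\<close>, \<open>Q\<close> is decreasing on \<open>{1..k}\<close>. If
  \<open>u m \<ge> Q (m + 1)\<close> for all \<open>m < n\<close>, where \<open>n < k\<close>, then every \<open>u (n - l)\<close> with \<open>1 \<le> l \<le> n\<close> is at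
  least \<open>Q n\<close>, and the renewal equation gives \<open>u n \<ge> P n * Q n = Q (n + 1)\<close>: this is
  \<open>renewal_ge_Q_Suc\<close>.

  For \<open>n \<ge> k\<close> the weights \<open>p 1, \<dots>, p k\<close> in the renewal equation sum to one, so \<open>u n\<close> is a
  convex combination of the \<open>k\<close> masses before it and inherits any common lower bound of these
  (\<open>renewal_ge_of_window\<close>). For \<open>n = k\<close> this gives \<open>u k \<ge> Q k\<close>; for \<open>n > k\<close> it shows that the
  minimum over all \<open>n \<ge> 1\<close> is already attained on \<open>{1..k}\<close>, where \<open>Q k\<close> is a lower bound.

  The renewal equation itself is obtained by conditioning on the step with which the walk reaches
  \<open>n\<close>, i.e. on the last step rather than the first. This needs only the independence of the step
  \<open>X (j + 1)\<close> from the position \<open>S j\<close>; conditioning on the first step would in addition require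
  that the shifted walk has the law of the original one.
\<close>

section \<open>The renewal equation\<close>

lemma (in prob_space) walk_renewal_facts:
  assumes X: "indep_vars (\<lambda>_. count_space {1..k}) X {1..}"
  shows walk_step_measurable: "i \<ge> 1 \<Longrightarrow> X i \<in> measurable M (count_space {1..k})"
    and walk_step_range: "i \<ge> 1 \<Longrightarrow> \<omega> \<in> space M \<Longrightarrow> X i \<omega> \<in> {1..k}"
proof -
  show meas: "X i \<in> measurable M (count_space {1..k})" if "i \<ge> 1" for i
    using X that unfolding indep_vars_def by auto
  show "X i \<omega> \<in> {1..k}" if "i \<ge> 1" "\<omega> \<in> space M" for i
    using measurable_space[OF meas[OF that(1)] that(2)] by simp
qed

lemma walk_Suc: "walk X (Suc n) \<omega> = walk X n \<omega> + X (Suc n) \<omega>"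
  by (simp add: walk_def)

lemma (in prob_space) walk_strict_mono:
  assumes "indep_vars (\<lambda>_. count_space {1..k}) X {1..}" and "\<omega> \<in> space M"
  shows "strict_mono (\<lambda>j. walk X j \<omega>)"
proof -
  have "X (Suc j) \<omega> \<ge> 1" for j
    using walk_step_range[OF assms(1) _ assms(2), of "Suc j"] by simp
  then show ?thesis
    by (simp add: strict_mono_Suc_iff walk_Suc Suc_le_eq)
qed

text \<open>The position at time \<open>j\<close> is a function of the block \<open>X 1, \<dots>, X j\<close> alone, and disjoint
  blocks of an independent family are independent.\<close>

lemma (in prob_space) indep_walk_next_step:
  assumes "indep_vars (\<lambda>_. count_space {1..k}) X {1..}"
  shows "indep_var (count_space UNIV) (walk X j) (count_space {1..k}) (X (Suc j))"
proof -
  let ?N = "\<lambda>_. count_space {1..k}"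
  have "indep_var (PiM {1..j} ?N) (\<lambda>\<omega>. restrict (\<lambda>i. X i \<omega>) {1..j})
                  (PiM {Suc j} ?N) (\<lambda>\<omega>. restrict (\<lambda>i. X i \<omega>) {Suc j})"
    by (rule indep_var_restrict[OF assms]) auto
  moreover have "(\<lambda>f. \<Sum>i=1..j. f i) \<in> measurable (PiM {1..j} ?N) (count_space (UNIV :: nat set))"
  proof (rule measurable_sum_nat)
    fix i assume "i \<in> {1..j}"
    then have "(\<lambda>f. f i) \<in> measurable (PiM {1..j} ?N) (count_space {1..k})"
      by (rule measurable_component_singleton)
    then show "(\<lambda>f. f i) \<in> measurable (PiM {1..j} ?N) (count_space UNIV)"
      by (rule measurable_compose) simp
  qed
  moreover have "(\<lambda>f. f (Suc j)) \<in> measurable (PiM {Suc j} ?N) (count_space {1..k})"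
    by (rule measurable_component_singleton) simp
  ultimately have "indep_var (count_space UNIV)
      ((\<lambda>f. \<Sum>i=1..j. f i) \<circ> (\<lambda>\<omega>. restrict (\<lambda>i. X i \<omega>) {1..j})) (count_space {1..k})
      ((\<lambda>f. f (Suc j)) \<circ> (\<lambda>\<omega>. restrict (\<lambda>i. X i \<omega>) {Suc j}))"
    by (rule indep_var_compose)
  then show ?thesis
    by (simp add: comp_def walk_def[abs_def])
qed

lemma (in prob_space) walk_measurable:
  assumes "indep_vars (\<lambda>_. count_space {1..k}) X {1..}"
  shows "walk X j \<in> measurable M (count_space UNIV)"
  using indep_var_rv1[OF indep_walk_next_step[OF assms]] .

lemma (in prob_space) walk_event:
  assumes "indep_vars (\<lambda>_. count_space {1..k}) X {1..}"
  shows "{\<omega>\<in>space M. walk X j \<omega> = n} \<in> events"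
  using measurable_sets[OF walk_measurable[OF assms], of "{n}" j]
  by (simp add: vimage_def Int_def conj_commute)

text \<open>Split according to the value \<open>l\<close> of the last step, which is independent of the position
  before it. Values \<open>l > n\<close> are left out of the sum: they cannot lead to \<open>n\<close>, but the truncated
  difference \<open>n - l = 0\<close> would count them.\<close>

lemma step_sequence_prob_walk_Suc:
  assumes "step_sequence M k p X"
  shows "measure M {\<omega>\<in>space M. walk X (Suc j) \<omega> = n} =
    (\<Sum>l=1..min n k. p l * measure M {\<omega>\<in>space M. walk X j \<omega> = n - l})"
proof -
  interpret prob_space M using assms by (simp add: step_sequence_def)
  have X: "indep_vars (\<lambda>_. count_space {1..k}) X {1..}"
    and p: "\<And>i l. i \<ge> 1 \<Longrightarrow> l \<in> {1..k} \<Longrightarrow> prob {\<omega>\<in>space M. X i \<omega> = l} = p l"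
    using assms by (auto simp: step_sequence_def)
  define A where "A l = (walk X j -` {n - l} \<inter> space M) \<inter> (X (Suc j) -` {l} \<inter> space M)" for l
  have "{\<omega>\<in>space M. walk X (Suc j) \<omega> = n} = (\<Union>l\<in>{1..min n k}. A l)"
  proof (intro equalityI subsetI)
    fix \<omega> assume "\<omega> \<in> {\<omega>\<in>space M. walk X (Suc j) \<omega> = n}"
    then have "\<omega> \<in> A (X (Suc j) \<omega>)" "X (Suc j) \<omega> \<in> {1..min n k}"
      using walk_step_range[OF X, of "Suc j" \<omega>] by (auto simp: A_def walk_Suc)
    then show "\<omega> \<in> (\<Union>l\<in>{1..min n k}. A l)" by blast
  qed (auto simp: A_def walk_Suc)
  moreover have "A l \<in> events" if "l \<in> {1..min n k}" for l
    unfolding A_def using that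
    by (intro sets.Int measurable_sets[OF walk_measurable[OF X]]
        measurable_sets[OF walk_step_measurable[OF X]]) auto
  moreover have "disjoint_family_on A {1..min n k}"
    by (auto simp: disjoint_family_on_def A_def)
  ultimately have "prob {\<omega>\<in>space M. walk X (Suc j) \<omega> = n} = (\<Sum>l=1..min n k. prob (A l))"
    using finite_measure_finite_Union[of "{1..min n k}" A] by (simp add: image_subset_iff)
  also have "\<dots> = (\<Sum>l=1..min n k. p l * prob {\<omega>\<in>space M. walk X j \<omega> = n - l})"
  proof (rule sum.cong[OF refl])
    fix l assume l: "l \<in> {1..min n k}"
    have "prob (A l) = prob (walk X j -` {n - l} \<inter> space M) * prob (X (Suc j) -` {l} \<inter> space M)"
      using indep_varD[OF indep_walk_next_step[OF X], of "{n - l}" "{l}" j] l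
      by (simp add: A_def vimage_def Int_def conj_ac)
    also have "X (Suc j) -` {l} \<inter> space M = {\<omega>\<in>space M. X (Suc j) \<omega> = l}" by auto
    also have "walk X j -` {n - l} \<inter> space M = {\<omega>\<in>space M. walk X j \<omega> = n - l}" by auto
    finally show "prob (A l) = p l * prob {\<omega>\<in>space M. walk X j \<omega> = n - l}"
      using p[of "Suc j" l] l by simp
  qed
  finally show ?thesis .
qed

text \<open>Steps are at least 1, so the walk visits \<open>n\<close> at most once and only at a time \<open>j \<le> n\<close>. The
  cut-off \<open>N\<close> is left free so that the masses \<open>u (n - l)\<close> for different \<open>l\<close> can be written as sums
  over one common range of times.\<close>

lemma (in prob_space) renewal_mass_eq_sum_prob_walk:
  assumes X: "indep_vars (\<lambda>_. count_space {1..k}) X {1..}" and "n \<le> N"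
  shows "renewal_mass M X n = (\<Sum>j\<le>N. prob {\<omega>\<in>space M. walk X j \<omega> = n})"
proof -
  note mono = walk_strict_mono[OF X]
  have "j \<le> N" if "\<omega> \<in> space M" "walk X j \<omega> = n" for j \<omega>
    using strict_mono_imp_increasing[OF mono[OF that(1)], of j] that(2) \<open>n \<le> N\<close> by simp
  then have "{\<omega> \<in> space M. n \<in> range (\<lambda>j. walk X j \<omega>)} =
      (\<Union>j\<in>{..N}. {\<omega>\<in>space M. walk X j \<omega> = n})"
    by auto
  moreover have "disjoint_family_on (\<lambda>j. {\<omega>\<in>space M. walk X j \<omega> = n}) {..N}"
    using strict_mono_eq[OF mono] by (auto simp: disjoint_family_on_def)
  ultimately show ?thesis
    unfolding renewal_mass_def using walk_event[OF X]
    by (simp add: finite_measure_finite_Union image_subset_iff)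
qed

lemma renewal_mass_0:
  assumes "prob_space M"
  shows "renewal_mass M X 0 = 1"
proof -
  have "0 \<in> range (\<lambda>j. walk X j \<omega>)" for \<omega>
    by (rule range_eqI[of _ _ 0]) (simp add: walk_def)
  then show ?thesis
    using prob_space.prob_space[OF assms] by (simp add: renewal_mass_def)
qed

text \<open>Sum the one-step equation over the times \<open>1, \<dots>, n\<close>; time 0 contributes nothing because the
  walk starts at 0.\<close>

lemma renewal_equation:
  assumes "step_sequence M k p X" and "n \<ge> 1"
  shows "renewal_mass M X n = (\<Sum>l=1..min n k. p l * renewal_mass M X (n - l))"
proof -
  interpret prob_space M using assms by (simp add: step_sequence_def)
  have X: "indep_vars (\<lambda>_. count_space {1..k}) X {1..}"
    using assms by (auto simp: step_sequence_def)
  let ?P = "\<lambda>j n. prob {\<omega>\<in>space M. walk X j \<omega> = n}"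
  obtain N where n: "n = Suc N" using \<open>n \<ge> 1\<close> by (cases n) auto
  have "renewal_mass M X n = ?P 0 n + (\<Sum>j\<le>N. ?P (Suc j) n)"
    unfolding renewal_mass_eq_sum_prob_walk[OF X order_refl]
    by (simp only: n sum.atMost_Suc_shift)
  also have "?P 0 n = 0" using n by (simp add: walk_def)
  also have "(\<Sum>j\<le>N. ?P (Suc j) n) = (\<Sum>l=1..min n k. p l * (\<Sum>j\<le>N. ?P j (n - l)))"
    unfolding step_sequence_prob_walk_Suc[OF assms(1)] sum_distrib_left by (rule sum.swap)
  also have "\<dots> = (\<Sum>l=1..min n k. p l * renewal_mass M X (n - l))"
  proof (rule sum.cong[OF refl])
    fix l assume "l \<in> {1..min n k}"
    then have "n - l \<le> N" using n by auto
    then show "p l * (\<Sum>j\<le>N. ?P j (n - l)) = p l * renewal_mass M X (n - l)"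
      by (simp only: renewal_mass_eq_sum_prob_walk[OF X])
  qed
  finally show ?thesis by simp
qed

section \<open>Lower bounds from the renewal equation\<close>

context
  fixes k :: nat and p u :: "nat \<Rightarrow> real"
  assumes p_nonneg: "\<And>l. l \<in> {1..k} \<Longrightarrow> p l \<ge> 0"
    and p_sum: "(\<Sum>l=1..k. p l) = 1"
    and u_0: "u 0 = 1"
    and u_rec: "\<And>n. n \<ge> 1 \<Longrightarrow> u n = (\<Sum>l=1..min n k. p l * u (n - l))"
begin

lemma Q_Suc: "n \<ge> 1 \<Longrightarrow> Q p (Suc n) = Q p n * (\<Sum>l=1..n. p l)"
  by (cases n) (simp_all add: Q_def)

lemma Q_antimono:
  assumes "m \<le> n" "n \<le> k" "m \<ge> 1"
  shows "Q p n \<le> Q p m"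
  using assms
proof (induction n rule: dec_induct)
  case (step n)
  have "0 \<le> Q p n"
    unfolding Q_def using step p_nonneg by (intro prod_nonneg ballI sum_nonneg) auto
  moreover have "(\<Sum>l=1..n. p l) \<le> (\<Sum>l=1..k. p l)"
    using step p_nonneg by (intro sum_mono2) auto
  ultimately have "Q p (Suc n) \<le> Q p n"
    using step p_sum by (simp add: Q_Suc mult_left_le)
  then show ?case using step by simp
qed simp

text \<open>Replacing each \<open>u (n - l)\<close> in the renewal equation by the smallest of the inductive bounds
  \<open>Q (n - l + 1)\<close>, namely \<open>Q n\<close>, leaves exactly \<open>P n * Q n\<close>.\<close>

lemma renewal_ge_Q_Suc: "n < k \<Longrightarrow> u n \<ge> Q p (Suc n)"
proof (induction n rule: less_induct)
  case (less n)
  show ?case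
  proof (cases "n = 0")
    case True
    then show ?thesis by (simp add: Q_def u_0)
  next
    case False
    have "Q p (Suc n) = (\<Sum>l=1..n. p l * Q p n)"
      using False by (simp add: Q_Suc mult.commute flip: sum_distrib_right)
    also have "\<dots> \<le> (\<Sum>l=1..n. p l * u (n - l))"
    proof (intro sum_mono mult_left_mono)
      fix l assume l: "l \<in> {1..n}"
      then have "Q p n \<le> Q p (Suc (n - l))"
        using less.prems by (intro Q_antimono) auto
      also have "\<dots> \<le> u (n - l)" using l less by auto
      finally show "Q p n \<le> u (n - l)" .
    qed (use p_nonneg less.prems in auto)
    also have "\<dots> = u n" using u_rec[of n] False less.prems by (simp add: min_def)
    finally show ?thesis .
  qed
qed

text \<open>From \<open>k\<close> on the renewal equation is a convex combination of the preceding \<open>k\<close> values.\<close>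

lemma renewal_ge_of_window:
  assumes "n \<ge> k" "n \<ge> 1" and "\<And>m. n - k \<le> m \<Longrightarrow> m < n \<Longrightarrow> c \<le> u m"
  shows "c \<le> u n"
proof -
  have "c = (\<Sum>l=1..k. p l * c)" using p_sum by (simp flip: sum_distrib_right)
  also have "\<dots> \<le> (\<Sum>l=1..k. p l * u (n - l))"
    using assms p_nonneg by (intro sum_mono mult_left_mono) auto
  also have "\<dots> = u n" using u_rec[of n] assms by (simp add: min_def)
  finally show ?thesis .
qed

lemma renewal_ge_Q:
  assumes "n \<in> {1..k}"
  shows "u n \<ge> Q p k"
proof (cases "n = k")
  case True
  have "Q p k \<le> u m" if "m < k" for m
    using Q_antimono[of "Suc m" k] renewal_ge_Q_Suc[of m] that by simp
  then show ?thesis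
    using assms True renewal_ge_of_window[of k "Q p k"] by auto
next
  case False
  then show ?thesis
    using Q_antimono[of "Suc n" k] renewal_ge_Q_Suc[of n] assms by simp
qed

text \<open>The least of \<open>u 1, \<dots>, u k\<close> propagates as a lower bound to all later values, through windows
  \<open>{n - k..<n}\<close> that for \<open>n > k\<close> avoid the index 0.\<close>

lemma renewal_min_attained:
  assumes "k \<ge> 1"
  shows "\<exists>l\<in>{1..k}. \<forall>n\<ge>1. u l \<le> u n"
proof -
  have "finite (u ` {1..k})" "u ` {1..k} \<noteq> {}" using assms by auto
  from Min_in[OF this] obtain l where l: "l \<in> {1..k}" "u l = Min (u ` {1..k})" by auto
  have "u l \<le> u n" if "n \<ge> 1" for n
    using that
  proof (induction n rule: less_induct)
    case (less n)
    show ?case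
    proof (cases "n \<le> k")
      case True
      then show ?thesis using l(2) less.prems by simp
    next
      case False
      show ?thesis
      proof (rule renewal_ge_of_window)
        fix m assume "n - k \<le> m" "m < n"
        then show "u l \<le> u m" using False by (intro less.IH) linarith+
      qed (use False less.prems in linarith)+
    qed
  qed
  then show ?thesis using l(1) by blast
qed

end

theorem proposition3p5:
  fixes k :: nat and p :: "nat \<Rightarrow> real"
    and M :: "'a measure" and X :: "nat \<Rightarrow> 'a \<Rightarrow> nat"
  assumes "k \<ge> 1"
    and "\<And>l. l \<in> {1..k} \<Longrightarrow> p l \<ge> 0"
    and "(\<Sum>l=1..k. p l) = 1"
    and "step_sequence M k p X"
  shows "min_renewal_mass M X \<ge> Q p k \<and>
         (\<forall>n\<in>{1..k-1}. renewal_mass M X n \<ge> Q p (n + 1))"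
proof -
  let ?u = "renewal_mass M X"
  have u0: "?u 0 = 1"
    using assms(4) by (intro renewal_mass_0) (simp add: step_sequence_def)
  note rec = renewal_equation[OF assms(4)]
  obtain l where l: "l \<in> {1..k}" "\<forall>n\<ge>1. ?u l \<le> ?u n"
    using renewal_min_attained[of k p ?u, OF assms(2,3) u0 rec assms(1)] by blast
  have "min_renewal_mass M X = ?u l"
    unfolding min_renewal_mass_def using l by (intro Least_equality) auto
  moreover have "?u l \<ge> Q p k"
    by (rule renewal_ge_Q[of k p ?u, OF assms(2,3) u0 rec l(1)])
  moreover have "?u n \<ge> Q p (n + 1)" if "n \<in> {1..k-1}" for n
    using renewal_ge_Q_Suc[of k p ?u, OF assms(2,3) u0 rec, of n] that by auto
  ultimately show ?thesis by simp
qed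

end
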